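(* Let $m,k$ be positive integers, let $\pi$ be a permutation of rectangular shape $(m^k)=(m,\dots,m)$ ($k$ parts equal to $m$), and let $\mu$ be an arbitrary partition. Then $\mu$ is the shape of some subsequence of $\pi$ if and only if $\mu\subseteq (m^k)$.
   Context: The Robinson-Schensted(-Knuth) correspondence (by row insertion) associates to a permutation $\pi=(\pi_1,\dots,\pi_n)\in S_n$, written as a word, or more generally to a finite sequence of distinct integers, a pair of tableaux of the same shape; this common shape, a partition of the length of the sequence, is called the shape of the permutation (or sequence). A subsequence of $\pi$ is a sequence $(\pi_{i_1},\dots,\pi_{i_r})$ with $i_1<\dots<i_r$, and its shape is its shape as a sequence of distinct integers. For partitions $\mu=(\mu_1,\mu_2,\dots)$ and $\lambda=(\lambda_1,\lambda_2,\dots)$ (padded by zeros, not necessarily of the same number), $\mu\subseteq\lambda$ means $\mu_i\le\lambda_i$ for all $i$. *)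

theory Defs
  imports
    "HOL-Library.Sublist"
    "HOL-Library.More_List"
    "HOL-Combinatorics.Multiset_Permutations"
begin

text \<open>
  Tableaux are lists of rows, the first (longest) row first. Insertion into a row
  replaces the leftmost entry greater than \<open>x\<close> and returns it as the bumped entry;
  if there is none, \<open>x\<close> is appended and \<^const>\<open>None\<close> is returned.
\<close>

fun row_insert :: "'a::linorder \<Rightarrow> 'a list \<Rightarrow> 'a list \<times> 'a option" where
  "row_insert x [] = ([x], None)"
| "row_insert x (y # ys) =
     (if x < y then (x # ys, Some y)
      else let (zs, b) = row_insert x ys in (y # zs, b))"

text \<open>The second component is the (0-based) index of the row that gained a box.\<close>

fun tableau_insert :: "'a::linorder \<Rightarrow> 'a list list \<Rightarrow> 'a list list \<times> nat" where
  "tableau_insert x [] = ([[x]], 0)"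
| "tableau_insert x (r # rs) =
     (case row_insert x r of
        (r', None) \<Rightarrow> (r' # rs, 0)
      | (r', Some y) \<Rightarrow> (let (rs', i) = tableau_insert y rs in (r' # rs', Suc i)))"

fun add_box :: "'b \<Rightarrow> nat \<Rightarrow> 'b list list \<Rightarrow> 'b list list" where
  "add_box t i [] = [[t]]"
| "add_box t 0 (r # rs) = (r @ [t]) # rs"
| "add_box t (Suc i) (r # rs) = r # add_box t i rs"

fun rs_step :: "'a::linorder list list \<times> nat list list \<Rightarrow> nat \<times> 'a \<Rightarrow> 'a list list \<times> nat list list"
  where
  "rs_step (P, Q) (t, x) = (let (P', i) = tableau_insert x P in (P', add_box t i Q))"

text \<open>The pair of insertion tableau and recording tableau.\<close>

definition robinson_schensted :: "'a::linorder list \<Rightarrow> 'a list list \<times> nat list list" where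
  "robinson_schensted w = foldl rs_step ([], []) (enumerate 1 w)"

definition tableau_shape :: "'b list list \<Rightarrow> nat list" where
  "tableau_shape T = map length T"

definition rs_shape :: "'a::linorder list \<Rightarrow> nat list" where
  "rs_shape w = tableau_shape (fst (robinson_schensted w))"

text \<open>Partitions are represented without trailing zeros, so that equal partitions are equal lists.\<close>

definition is_partition :: "nat list \<Rightarrow> bool" where
  "is_partition \<mu> \<longleftrightarrow> sorted_wrt (\<ge>) \<mu> \<and> 0 \<notin> set \<mu>"

definition partition_contained :: "nat list \<Rightarrow> nat list \<Rightarrow> bool" where
  "partition_contained \<mu> \<nu> \<longleftrightarrow> (\<forall>i. nth_default 0 \<mu> i \<le> nth_default 0 \<nu> i)"

lemma length_row_insert:
  "length (fst (row_insert x r)) = (if snd (row_insert x r) = None then Suc (length r) else length r)"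
  by (induction r) (auto split: prod.splits)

lemma shape_tableau_insert:
  "tableau_shape Q = tableau_shape P \<Longrightarrow>
     tableau_shape (add_box t (snd (tableau_insert x P)) Q) = tableau_shape (fst (tableau_insert x P))"
proof (induction x P arbitrary: Q rule: tableau_insert.induct)
  case (1 x)
  then show ?case by (simp add: tableau_shape_def)
next
  case (2 x r rs)
  from "2.prems" obtain s ss where Q: "Q = s # ss" "length s = length r"
      "tableau_shape ss = tableau_shape rs"
    by (auto simp: tableau_shape_def Cons_eq_map_conv)
  obtain r' b where rb: "row_insert x r = (r', b)" by fastforce
  show ?case
  proof (cases b)
    case None
    then show ?thesis
      using Q rb length_row_insert[of x r] by (simp add: tableau_shape_def)
  next
    case (Some y)
    then show ?thesis
      using Q rb length_row_insert[of x r] "2.IH"[OF rb[symmetric] Some, of ss]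
      by (simp add: tableau_shape_def case_prod_beta)
  qed
qed

text \<open>Both tableaux have the same shape, so \<^const>\<open>rs_shape\<close> may be read off either.\<close>

lemma robinson_schensted_same_shape:
  "tableau_shape (snd (robinson_schensted w)) = tableau_shape (fst (robinson_schensted w))"
proof -
  have "tableau_shape (snd (foldl rs_step (P, Q) xs)) = tableau_shape (fst (foldl rs_step (P, Q) xs))"
    if "tableau_shape Q = tableau_shape P" for P :: "'a list list" and Q xs
    using that
  proof (induction xs arbitrary: P Q)
    case Nil
    then show ?case by simp
  next
    case (Cons a xs)
    obtain t x where a: "a = (t, x)" by fastforce
    obtain P' i where P': "tableau_insert x P = (P', i)" by fastforce
    have "tableau_shape (add_box t i Q) = tableau_shape P'"
      using shape_tableau_insert[OF Cons.prems, of t x] P' by simp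
    then show ?case using Cons.IH a P' by simp
  qed
  from this[of "[]" "[]"] show ?thesis by (simp add: robinson_schensted_def tableau_shape_def)
qed

end

(*
  Greene's upper bounds: r disjoint increasing (decreasing) subsequences of w cover at most as
  many letters as the first r rows (columns) of its shape. They are proved by pushing colourings
  along Knuth moves to the reading word of the insertion tableau. For shape (m^k) they show that
  each letter is determined by the lengths of the longest decreasing and increasing subsequences
  ending in it, so the letters form a k x m grid whose rows increase and whose columns decrease.
  The letters in the cells of mu form a subsequence whose shape dominates mu by the rows and is
  dominated by mu by the columns, hence equals mu. Conversely the k rows and m columns of the
  grid cover every subsequence, so its shape has at most k rows and m columns.
*)

theory Submission
  imports Defs
begin

section \<open>Coloured words and Knuth moves\<close>

text \<open>Colours below \<open>r\<close> name the classes, any other colour means uncoloured. Each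
  class is a strictly increasing subsequence and the classes are disjoint, so this encodes a family
  of \<open>r\<close> subsequences as in Greene's theorem. Colours hang on letters, hence words are
  taken to be distinct; decreasing families are colourings of the reversed word.\<close>

definition inc_colouring :: "nat \<Rightarrow> ('a::linorder \<Rightarrow> nat) \<Rightarrow> 'a list \<Rightarrow> bool" where
  "inc_colouring r c w \<longleftrightarrow> sorted_wrt (\<lambda>a b. c a < r \<and> c a = c b \<longrightarrow> a < b) w"

definition coloured :: "nat \<Rightarrow> ('a \<Rightarrow> nat) \<Rightarrow> 'a list \<Rightarrow> 'a set" where
  "coloured r c w = {a \<in> set w. c a < r}"

lemma finite_coloured [simp]: "finite (coloured r c w)"
  by (simp add: coloured_def)

text \<open>The elementary Knuth relations, oriented the way row insertion uses them. A rule is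
  named after the pattern of its left-hand word.\<close>

inductive knuth_step :: "'a::linorder list \<Rightarrow> 'a list \<Rightarrow> bool" where
  xzy: "x < y \<Longrightarrow> y < z \<Longrightarrow> knuth_step (u @ [x, z, y] @ v) (u @ [z, x, y] @ v)"
| yzx: "x < y \<Longrightarrow> y < z \<Longrightarrow> knuth_step (u @ [y, z, x] @ v) (u @ [y, x, z] @ v)"

lemma knuth_step_mset: "knuth_step w w' \<Longrightarrow> mset w' = mset w"
  by (induction rule: knuth_step.induct) auto

text \<open>Reversal exchanges the two rules together with the contexts \<open>u\<close> and
  \<open>v\<close>. This reduces decreasing colourings to increasing ones.\<close>

lemma knuth_step_rev: "knuth_step w w' \<Longrightarrow> knuth_step (rev w) (rev w')"
proof (induction rule: knuth_step.induct)
  case (xzy x y z u v)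
  from knuth_step.yzx[OF this, of "rev v" "rev u"] show ?case by simp
next
  case (yzx x y z u v)
  from knuth_step.xzy[OF this, of "rev v" "rev u"] show ?case by simp
qed

lemma knuth_step_append: "knuth_step w w' \<Longrightarrow> knuth_step (p @ w @ q) (p @ w' @ q)"
proof (induction rule: knuth_step.induct)
  case (xzy x y z u v)
  from knuth_step.xzy[OF this, of "p @ u" "v @ q"] show ?case by simp
next
  case (yzx x y z u v)
  from knuth_step.yzx[OF this, of "p @ u" "v @ q"] show ?case by simp
qed

lemma knuth_steps_append:
  "knuth_step\<^sup>*\<^sup>* w w' \<Longrightarrow> knuth_step\<^sup>*\<^sup>* (p @ w @ q) (p @ w' @ q)"
  by (induction rule: rtranclp_induct)
    (auto intro: rtranclp.rtrancl_into_rtrancl knuth_step_append)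

lemma knuth_steps_mset: "knuth_step\<^sup>*\<^sup>* w w' \<Longrightarrow> mset w' = mset w"
  by (induction rule: rtranclp_induct) (auto dest: knuth_step_mset)

lemma knuth_steps_rev: "knuth_step\<^sup>*\<^sup>* w w' \<Longrightarrow> knuth_step\<^sup>*\<^sup>* (rev w) (rev w')"
  by (induction rule: rtranclp_induct)
    (auto intro: rtranclp.rtrancl_into_rtrancl knuth_step_rev)

text \<open>
  The only obstruction is a colour class through \<open>x\<close> and \<open>z\<close>. If \<open>y\<close> is uncoloured it takes
  the place of \<open>z\<close>; otherwise the classes of \<open>z\<close> and \<open>y\<close> exchange their tails.
\<close>

lemma inc_colouring_xzy:
  assumes "distinct (u @ [x, z, y] @ v)" "x < y" "y < z"
    and col: "inc_colouring r c (u @ [x, z, y] @ v)"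
  shows "\<exists>c'. inc_colouring r c' (u @ [z, x, y] @ v) \<and>
    card (coloured r c' (u @ [z, x, y] @ v)) = card (coloured r c (u @ [x, z, y] @ v))"
proof -
  consider "\<not> (c x < r \<and> c x = c z)" | "c x < r" "c x = c z" "\<not> c y < r"
    | "c x < r" "c x = c z" "c y < r" by blast
  then show ?thesis
  proof cases
    case 1
    \<comment> \<open>Only the pair \<open>x\<close>, \<open>z\<close> changes its order, and here
      it lies in no common class.\<close>
    then have "inc_colouring r c (u @ [z, x, y] @ v)"
      using col by (auto simp: inc_colouring_def sorted_wrt_append)
    moreover have "coloured r c (u @ [z, x, y] @ v) = coloured r c (u @ [x, z, y] @ v)"
      by (auto simp: coloured_def)
    ultimately show ?thesis by metis
  next
    case 2
    define c' where "c' = c(y := c x, z := c y)"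
    have c': "c' y = c x" "c' z = c y" "c' x = c x"
        "\<And>a. a \<in> set u \<Longrightarrow> c' a = c a" "\<And>a. a \<in> set v \<Longrightarrow> c' a = c a"
      using assms by (auto simp: c'_def)
    have pw: "sorted_wrt (\<lambda>a b. c' a < r \<and> c' a = c' b \<longrightarrow> a < b) t" 
      if "sorted_wrt (\<lambda>a b. c a < r \<and> c a = c b \<longrightarrow> a < b) t" "\<forall>a \<in> set t. c' a = c a" for t
      using that by (induction t) auto
    have "inc_colouring r c' (u @ [z, x, y] @ v)"
      using col 2 assms(2,3) pw[of u] pw[of v]
      by (fastforce simp: inc_colouring_def sorted_wrt_append c')
    moreover have set_eq: "coloured r c' (u @ [z, x, y] @ v) = insert y (coloured r c (u @ [x, z, y] @ v) - {z})"
      using 2 assms(2,3) c' by (fastforce simp: coloured_def)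
    have "card (coloured r c' (u @ [z, x, y] @ v)) = card (coloured r c (u @ [x, z, y] @ v))"
    proof -
      have "y \<notin> coloured r c (u @ [x, z, y] @ v)" "z \<in> coloured r c (u @ [x, z, y] @ v)"
        using 2 by (auto simp: coloured_def)
      then have "card (insert y (coloured r c (u @ [x, z, y] @ v) - {z}))
          = Suc (card (coloured r c (u @ [x, z, y] @ v) - {z}))"
        by (intro card_insert_disjoint) auto
      then show ?thesis
        using \<open>z \<in> _\<close> set_eq by (metis card_Suc_Diff1 finite_coloured)
    qed
    ultimately show ?thesis by blast
  next
    case 3
    \<comment> \<open>\<open>z\<close> precedes \<open>y\<close> in the old word although
      \<open>y < z\<close>, so \<open>y\<close> cannot be in the class of \<open>x\<close> and
      \<open>z\<close>.\<close>
    have ne: "c y \<noteq> c x"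
      using col 3 assms(2,3) by (auto simp: inc_colouring_def sorted_wrt_append)
    define s where "s = transpose (c x) (c y)"
    define c' where "c' = (\<lambda>a. if a = y then c x else if a = z then c y
      else if a \<in> set v then s (c a) else c a)"
    have c': "c' y = c x" "c' z = c y" "c' x = c x"
        "\<And>a. a \<in> set u \<Longrightarrow> c' a = c a" "\<And>a. a \<in> set v \<Longrightarrow> c' a = s (c a)"
      using assms by (auto simp: c'_def)
    \<comment> \<open>Both exchanged colours are below \<open>r\<close>, so recolouring neither
      gains nor loses a coloured letter.\<close>
    have s: "s a < r \<longleftrightarrow> a < r" "s a = s b \<longleftrightarrow> a = b" "s a = c x \<longleftrightarrow> a = c y"
        "s a = c y \<longleftrightarrow> a = c x" "a \<noteq> c x \<Longrightarrow> a \<noteq> c y \<Longrightarrow> s a = a" for a b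
      using 3 ne by (auto simp: s_def transpose_def)
    have pu: "sorted_wrt (\<lambda>a b. c' a < r \<and> c' a = c' b \<longrightarrow> a < b) t"
      if "sorted_wrt (\<lambda>a b. c a < r \<and> c a = c b \<longrightarrow> a < b) t" "\<forall>a \<in> set t. c' a = c a" for t
      using that by (induction t) auto
    have pv: "sorted_wrt (\<lambda>a b. c' a < r \<and> c' a = c' b \<longrightarrow> a < b) t"
      if "sorted_wrt (\<lambda>a b. c a < r \<and> c a = c b \<longrightarrow> a < b) t" "\<forall>a \<in> set t. c' a = s (c a)" for t
      using that by (induction t) (auto simp: s)
    have old: "\<And>a. a \<in> set u \<Longrightarrow> c a = c x \<Longrightarrow> a < x" "\<And>a. a \<in> set u \<Longrightarrow> c a = c y \<Longrightarrow> a < y"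
        "\<And>b. b \<in> set v \<Longrightarrow> c b = c x \<Longrightarrow> z < b" "\<And>b. b \<in> set v \<Longrightarrow> c b = c y \<Longrightarrow> y < b"
        "\<And>a b. a \<in> set u \<Longrightarrow> b \<in> set v \<Longrightarrow> c a < r \<Longrightarrow> c a = c b \<Longrightarrow> a < b"
      using col 3 by (auto simp: inc_colouring_def sorted_wrt_append)
    \<comment> \<open>Where the exchanged tails meet the heads in \<open>u\<close>: the head of
      class \<open>c x\<close> stays below \<open>x < y\<close> and the head of class
      \<open>c y\<close> below \<open>y < z\<close>, so each lies below its new tail.\<close>
    have uv: "a < b" if "a \<in> set u" "b \<in> set v" "c a < r" "c a = s (c b)" for a b
    proof (cases "c b = c x \<or> c b = c y")
      case True
      then show ?thesis using old that s(3,4) assms(2,3)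
        by (metis less_trans)
    next
      case False
      then show ?thesis using old that s(5) by metis
    qed
    have flip: "c x = s (c b) \<longleftrightarrow> c b = c y" "c y = s (c b) \<longleftrightarrow> c b = c x" for b
      using s(3,4) by metis+
    have cross: "\<And>a. a \<in> set u \<Longrightarrow> c a = c y \<Longrightarrow> a < z"
        "\<And>a. a \<in> set u \<Longrightarrow> c a = c x \<Longrightarrow> a < y" "\<And>b. b \<in> set v \<Longrightarrow> c b = c y \<Longrightarrow> x < b"
        "\<And>b. b \<in> set v \<Longrightarrow> c b = c x \<Longrightarrow> y < b"
      using old assms(2,3) by (meson less_trans)+
    have "sorted_wrt (\<lambda>a b. c' a < r \<and> c' a = c' b \<longrightarrow> a < b) u"
        "sorted_wrt (\<lambda>a b. c' a < r \<and> c' a = c' b \<longrightarrow> a < b) v"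
      using col pu[of u] pv[of v] by (auto simp: inc_colouring_def sorted_wrt_append c')
    then have "inc_colouring r c' (u @ [z, x, y] @ v)"
      using assms(2) ne ne[symmetric]
      by (auto simp: inc_colouring_def sorted_wrt_append c' flip old cross uv)
    moreover have "coloured r c' (u @ [z, x, y] @ v) = coloured r c (u @ [x, z, y] @ v)"
      using 3 by (auto simp: coloured_def c' s)
    ultimately show ?thesis by metis
  qed
qed

lemma inc_colouring_knuth_step:
  assumes "knuth_step w w'" "distinct w" "inc_colouring r c w"
  shows "\<exists>c'. inc_colouring r c' w' \<and> card (coloured r c' w') = card (coloured r c w)"
  using assms
proof (cases rule: knuth_step.cases)
  case (xzy x y z u v)
  then show ?thesis using inc_colouring_xzy assms by blast
next
  case (yzx x y z u v)
  \<comment> \<open>Only the pair \<open>z\<close>, \<open>x\<close> changes its order, and it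
    becomes ascending, which every class allows.\<close>
  have "inc_colouring r c w'"
    using assms yzx by (auto simp: inc_colouring_def sorted_wrt_append)
  moreover have "coloured r c w' = coloured r c w"
    using yzx by (auto simp: coloured_def)
  ultimately show ?thesis by metis
qed

lemma inc_colouring_knuth_steps:
  assumes "knuth_step\<^sup>*\<^sup>* w w'" "distinct w" "inc_colouring r c w"
  shows "\<exists>c'. inc_colouring r c' w' \<and> card (coloured r c' w') = card (coloured r c w)"
  using assms(1)
proof (induction rule: rtranclp_induct)
  case base
  then show ?case using assms by blast
next
  case (step w' w'')
  then have "distinct w'"
    using knuth_steps_mset assms(2) by (metis mset_eq_imp_distinct_iff)
  then show ?case using step inc_colouring_knuth_step by metis
qed

section \<open>Row insertion\<close>

lemma row_insert_None: "row_insert x r = (r', None) \<Longrightarrow> r' = r @ [x] \<and> (\<forall>a\<in>set r. a \<le> x)"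
  by (induction r arbitrary: r') (auto split: if_splits prod.splits)

lemma row_insert_Some:
  "row_insert x r = (r', Some y) \<Longrightarrow>
     \<exists>p < length r. r' = r[p := x] \<and> y = r ! p \<and> x < y \<and> (\<forall>j<p. r ! j \<le> x)"
proof (induction r arbitrary: r')
  case (Cons a r)
  show ?case
  proof (cases "x < a")
    case True
    then show ?thesis using Cons.prems by (intro exI[of _ 0]) auto
  next
    case False
    then obtain zs where zs: "row_insert x r = (zs, Some y)" "r' = a # zs"
      using Cons.prems by (auto split: prod.splits)
    from Cons.IH[OF zs(1)] obtain p where "p < length r" "zs = r[p := x]" "y = r ! p" "x < y"
        "\<forall>j<p. r ! j \<le> x" by blast
    then show ?thesis using False zs(2)
      by (intro exI[of _ "Suc p"]) (auto simp: less_Suc_eq_0_disj)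
  qed
qed auto

text \<open>The small letter \<open>x\<close> passes the row letters from right to left by rule
  \<open>yzx\<close>, each time with the left neighbour as the middle value. It stops behind the
  first letter, which has no left neighbour in the row.\<close>

lemma knuth_steps_move_left:
  "x < y \<Longrightarrow> sorted_wrt (<) (y # ys) \<Longrightarrow> knuth_step\<^sup>*\<^sup>* (y # ys @ [x]) (y # x # ys)"
proof (induction ys arbitrary: y)
  case (Cons c ys)
  have "knuth_step\<^sup>*\<^sup>* (c # ys @ [x]) (c # x # ys)"
    using Cons by auto
  from knuth_steps_append[OF this, of "[y]" "[]"]
  have "knuth_step\<^sup>*\<^sup>* (y # (c # ys) @ [x]) (y # c # x # ys)" by simp
  also have "knuth_step (y # c # x # ys) (y # x # c # ys)"
    using knuth_step.yzx[of x y c "[]" ys] Cons.prems by simp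
  finally show ?case .
qed simp

text \<open>Once \<open>x\<close> has taken its place, the bumped letter \<open>y\<close> travels to
  the front by rule \<open>xzy\<close>. Its right neighbour \<open>z\<close> serves as the middle
  value when it passes \<open>a\<close>.\<close>

lemma knuth_steps_row_insert:
  "row_insert x r = (r', Some y) \<Longrightarrow> sorted_wrt (<) r \<Longrightarrow> x \<notin> set r \<Longrightarrow>
     knuth_step\<^sup>*\<^sup>* (r @ [x]) (y # r')"
proof (induction r arbitrary: r')
  case (Cons a r)
  show ?case
  proof (cases "x < a")
    case True
    then show ?thesis using Cons.prems knuth_steps_move_left by auto
  next
    case False
    then obtain zs where zs: "row_insert x r = (zs, Some y)" "r' = a # zs"
      using Cons.prems by (auto split: prod.splits)
    have sorted: "sorted_wrt (<) r" "x \<notin> set r" using Cons.prems by auto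
    from row_insert_Some[OF zs(1)] obtain p where p: "p < length r" "zs = r[p := x]" "y = r ! p"
      "x < y" "\<forall>j<p. r ! j \<le> x" by blast
    then have "zs \<noteq> []" by auto
    then obtain z zs' where z: "zs = z # zs'" by (auto simp: neq_Nil_conv)
    \<comment> \<open>\<open>z\<close> is \<open>x\<close> itself if the bump happens at the head of
      the tail, and otherwise the old head of the tail.\<close>
    have "a < z \<and> z < y"
    proof (cases p)
      case 0
      then show ?thesis using p z False Cons.prems by (cases r) auto
    next
      case (Suc q)
      then have "z = r ! 0" using p z by (cases r) auto
      moreover have "r ! 0 \<in> set r" using p by (intro nth_mem) auto
      then have "a < r ! 0" using Cons.prems by auto
      moreover have "r ! 0 < r ! p"
        using p Suc sorted(1) by (auto simp: sorted_wrt_iff_nth_less)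
      ultimately show ?thesis using p by simp
    qed
    have "knuth_step\<^sup>*\<^sup>* ((a # r) @ [x]) (a # y # zs)"
      using knuth_steps_append[OF Cons.IH[OF zs(1) sorted], of "[a]" "[]"] by simp
    also have "knuth_step (a # y # zs) (y # a # zs)"
      using knuth_step.xzy[of a z y "[]" zs'] \<open>a < z \<and> z < y\<close> z by simp
    finally show ?thesis using zs by simp
  qed
qed simp

section \<open>Tableaux and their reading words under insertion\<close>

fun tableau :: "'a::linorder list list \<Rightarrow> bool" where
  "tableau [] \<longleftrightarrow> True"
| "tableau (r # rs) \<longleftrightarrow> r \<noteq> [] \<and> sorted_wrt (<) r \<and> tableau rs \<and>
     (case rs of [] \<Rightarrow> True
      | s # _ \<Rightarrow> length s \<le> length r \<and> (\<forall>j<length s. r ! j < s ! j))"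

lemma sorted_wrt_bump:
  fixes r :: "'a::linorder list"
  assumes "sorted_wrt (<) r" "x \<notin> set r" "p < length r" "x < r ! p" "\<forall>j<p. r ! j \<le> x"
  shows "sorted_wrt (<) (r[p := x])"
proof -
  have "r ! j < x" if "j < p" for j
    using that assms by (metis nth_mem order.strict_trans order_le_less)
  moreover have "x < r ! j" if "p < j" "j < length r" for j
    using that assms by (metis sorted_wrt_iff_nth_less less_trans)
  moreover have "r ! i < r ! j" if "i < j" "j < length r" for i j
    using that assms(1) by (simp add: sorted_wrt_iff_nth_less)
  ultimately show ?thesis
    using assms(3) by (simp add: sorted_wrt_iff_nth_less nth_list_update)
qed

text \<open>With the bottom row read first, columns are read as decreasing sequences, and a letter
  appended to the word stands next to the first row, where insertion starts.\<close>

definition reading_word :: "'a list list \<Rightarrow> 'a list" where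
  "reading_word P = concat (rev P)"

lemma set_reading_word: "set (reading_word P) = \<Union> (set ` set P)"
  by (auto simp: reading_word_def)

lemma tableau_insert_neq_Nil: "fst (tableau_insert x P) \<noteq> []"
  by (cases "(x, P)" rule: tableau_insert.cases) (auto split: prod.splits option.splits)

lemma tableau_insert_hd:
  "hd (fst (tableau_insert y (s # ss))) = fst (row_insert y s)"
  by (auto split: prod.splits option.splits)

text \<open>Row insertion turns \<open>r @ [x]\<close> into \<open>y # r'\<close>, which puts
  \<open>y\<close> directly behind the reading word of \<open>rs\<close>, ready for the recursive
  insertion. Columns stay increasing because a letter bumped from column \<open>p\<close> lands in
  the next row in a column not right of \<open>p\<close>, below an entry at most
  \<open>x\<close>.\<close>

lemma knuth_steps_tableau_insert:
  assumes "tableau P" "distinct (reading_word P @ [x])"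
  shows "tableau (fst (tableau_insert x P)) \<and>
    knuth_step\<^sup>*\<^sup>* (reading_word P @ [x]) (reading_word (fst (tableau_insert x P)))"
  using assms
proof (induction x P rule: tableau_insert.induct)
  case (1 x)
  then show ?case by (simp add: reading_word_def)
next
  case (2 x r rs)
  have r: "sorted_wrt (<) r" "x \<notin> set r" "r \<noteq> []" "tableau rs"
    using "2.prems" by (auto simp: reading_word_def)
  show ?case
  proof (cases "snd (row_insert x r)")
    case None
    then obtain r' where r': "row_insert x r = (r', None)" by (metis prod.collapse)
    from row_insert_None[OF r'] have "r' = r @ [x]" "\<forall>a\<in>set r. a < x"
      using r(2) by (auto simp: order_le_less)
    then show ?thesis using r' "2.prems"
      by (auto simp: reading_word_def sorted_wrt_append nth_append split: list.splits)
  next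
    case (Some y)
    then obtain r' where r': "row_insert x r = (r', Some y)" by (metis prod.collapse)
    from row_insert_Some[OF r'] obtain p where p: "p < length r" "r' = r[p := x]" "y = r ! p"
      "x < y" "\<forall>j<p. r ! j \<le> x" by blast
    have y: "y \<in> set r" using p by simp
    obtain rs' i where rs': "tableau_insert y rs = (rs', i)" by fastforce
    have dist: "distinct (reading_word rs @ [y])"
      using "2.prems" y by (auto simp: reading_word_def)
    have IH: "tableau rs'" "knuth_step\<^sup>*\<^sup>* (reading_word rs @ [y]) (reading_word rs')"
      using "2.IH"[OF r'[symmetric] refl r(4) dist] rs' by auto
    have ins: "fst (tableau_insert x (r # rs)) = r' # rs'"
      using r' rs' by simp
    have "knuth_step\<^sup>*\<^sup>* (reading_word (r # rs) @ [x]) (reading_word rs @ y # r')"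
      using knuth_steps_append[OF knuth_steps_row_insert[OF r' r(1,2)], of "reading_word rs" "[]"]
      by (simp add: reading_word_def)
    also have "knuth_step\<^sup>*\<^sup>* (reading_word rs @ y # r') (reading_word (r' # rs'))"
      using knuth_steps_append[OF IH(2), of "[]" r'] by (simp add: reading_word_def)
    finally have K: "knuth_step\<^sup>*\<^sup>* (reading_word (r # rs) @ [x]) (reading_word (r' # rs'))" .
    have sorted: "sorted_wrt (<) r'"
      using sorted_wrt_bump r p by metis
    \<comment> \<open>Bumping only lowers entries of the upper row, so columns whose lower entry is
      unchanged remain increasing.\<close>
    have below: "r' ! j \<le> r ! j" if "j < length r" for j
      using that p by (cases "j = p") auto
    have le_x: "r' ! j \<le> x" if "j \<le> p" for j
      using that p by (cases "j = p") auto
    have "case rs' of [] \<Rightarrow> True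
      | s # _ \<Rightarrow> length s \<le> length r' \<and> (\<forall>j<length s. r' ! j < s ! j)"
    proof (cases rs)
      case Nil
      then have "rs' = [[y]]" using rs' by simp
      then show ?thesis using p r le_x[of 0] by (auto simp: Suc_le_eq)
    next
      case (Cons s ss)
      have s: "length s \<le> length r" "\<forall>j<length s. r ! j < s ! j"
        using "2.prems" Cons by auto
      obtain s' b where s': "row_insert y s = (s', b)" by fastforce
      have hd: "rs' \<noteq> []" "hd rs' = s'"
        using tableau_insert_neq_Nil[of y rs] tableau_insert_hd[of y s ss] rs' s' Cons by auto
      have "length s' \<le> length r' \<and> (\<forall>j<length s'. r' ! j < s' ! j)"
      proof (cases b)
        case None
        have s'_def: "s' = s @ [y]" "\<forall>a\<in>set s. a \<le> y"
          using row_insert_None s' None by blast+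
        \<comment> \<open>If \<open>s\<close> reached column \<open>p\<close>, its entry there would
          exceed \<open>r ! p = y\<close>, yet all entries of \<open>s\<close> are at most
          \<open>y\<close>.\<close>
        have len: "length s \<le> p"
          using s'_def(2) s(2) p by (metis leI nth_mem leD)
        then have "r' ! j < s' ! j" if "j < length s'" for j
        proof (cases "j = length s")
          case True
          then show ?thesis using le_x[OF len] p s'_def by simp
        next
          case False
          then have "j < length s" using that s'_def by simp
          then show ?thesis using below[of j] s s'_def by (auto simp: nth_append intro: le_less_trans)
        qed
        then show ?thesis using len p s'_def by auto
      next
        case (Some z)
        then obtain q where q: "q < length s" "s' = s[q := y]" "z = s ! q" "y < z"
            "\<forall>j<q. s ! j \<le> y"
          using row_insert_Some s' by blast
        \<comment> \<open>If \<open>p < q\<close>, then \<open>s ! p \<le> y = r ! p\<close>,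
          against the strict increase in column \<open>p\<close>.\<close>
        have qp: "q \<le> p"
          using q s p by (metis leD leI less_trans)
        have "r' ! j < s' ! j" if "j < length s'" for j
        proof (cases "j = q")
          case True
          then show ?thesis using le_x[OF qp] p q by (auto intro: le_less_trans)
        next
          case False
          then show ?thesis using that below[of j] s q by (auto intro: le_less_trans)
        qed
        then show ?thesis using s q p by auto
      qed
      then show ?thesis using hd by (cases rs') auto
    qed
    moreover have "r' \<noteq> []" using p by auto
    ultimately have "tableau (r' # rs')"
      using sorted IH(1) by simp
    then show ?thesis using K ins by simp
  qed
qed

lemma fst_foldl_rs_step:
  "fst (foldl rs_step (P, Q) xs) = foldl (\<lambda>P x. fst (tableau_insert x P)) P (map snd xs)"
  by (induction xs arbitrary: P Q) (auto simp: case_prod_beta)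

lemma fst_robinson_schensted:
  "fst (robinson_schensted w) = foldl (\<lambda>P x. fst (tableau_insert x P)) [] w"
  by (simp add: robinson_schensted_def fst_foldl_rs_step)

text \<open>Knuth steps remain valid when a letter is appended on the right, and inserting that
  letter continues them.\<close>

lemma robinson_schensted_knuth_steps:
  assumes "distinct w"
  shows "tableau (fst (robinson_schensted w)) \<and>
    knuth_step\<^sup>*\<^sup>* w (reading_word (fst (robinson_schensted w)))"
  using assms
proof (induction w rule: rev_induct)
  case Nil
  then show ?case by (simp add: fst_robinson_schensted reading_word_def)
next
  case (snoc x w)
  let ?P = "fst (robinson_schensted w)"
  have IH: "tableau ?P" "knuth_step\<^sup>*\<^sup>* w (reading_word ?P)"
    using snoc by auto
  have K: "knuth_step\<^sup>*\<^sup>* (w @ [x]) (reading_word ?P @ [x])"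
    using knuth_steps_append[OF IH(2), of "[]" "[x]"] by simp
  then have "distinct (reading_word ?P @ [x])"
    using snoc.prems knuth_steps_mset mset_eq_imp_distinct_iff by blast
  from knuth_steps_tableau_insert[OF IH(1) this] rtranclp_trans[OF K] show ?case
    by (simp add: fst_robinson_schensted)
qed

section \<open>Greene's bounds\<close>

lemma tableau_nth_Suc:
  "tableau P \<Longrightarrow> Suc i < length P \<Longrightarrow>
     length (P ! Suc i) \<le> length (P ! i) \<and> (\<forall>j<length (P ! Suc i). P ! i ! j < P ! Suc i ! j)"
proof (induction P arbitrary: i)
  case (Cons r rs)
  then show ?case by (cases i) (auto split: list.splits)
qed simp

lemma tableau_nth:
  assumes "tableau P" "i < i'" "i' < length P"
  shows "length (P ! i') \<le> length (P ! i) \<and> (\<forall>j<length (P ! i'). P ! i ! j < P ! i' ! j)"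
  using assms(2,3)
proof (induction i')
  case (Suc i')
  have step: "length (P ! Suc i') \<le> length (P ! i')"
      "\<forall>j<length (P ! Suc i'). P ! i' ! j < P ! Suc i' ! j"
    using tableau_nth_Suc[OF assms(1)] Suc.prems by auto
  show ?case
  proof (cases "i = i'")
    case False
    then have "length (P ! i') \<le> length (P ! i)" "\<forall>j<length (P ! i'). P ! i ! j < P ! i' ! j"
      using Suc by auto
    then show ?thesis using step by (meson le_trans less_le_trans less_trans)
  qed (use step in simp)
qed simp

text \<open>Lower rows have larger indices but are read first, so \<open>a\<close> precedes
  \<open>b\<close> in the reading word.\<close>

lemma sorted_wrt_reading_word:
  assumes "sorted_wrt Q (reading_word P)" "i < i'" "i' < length P" "a \<in> set (P ! i')" "b \<in> set (P ! i)"
  shows "Q a b"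
  using assms
proof (induction P arbitrary: i i')
  case (Cons r rs)
  have word: "reading_word (r # rs) = reading_word rs @ r" by (simp add: reading_word_def)
  obtain i'' where i'': "i' = Suc i''" using Cons.prems by (cases i') auto
  show ?case
  proof (cases i)
    case 0
    have "a \<in> set (reading_word rs)" "b \<in> set r"
      using Cons.prems 0 i'' by (auto simp: set_reading_word)
    then show ?thesis using Cons.prems(1) by (auto simp: word sorted_wrt_append)
  next
    case (Suc l)
    then show ?thesis using Cons i'' by (auto simp: word sorted_wrt_append)
  qed
qed simp

text \<open>The initial segment \<open>D\<close> either lies below \<open>r\<close> or contains all
  of \<open>{..<r}\<close>. In the application \<open>D\<close> consists of the rows met by a column
  and \<open>T\<close> of those with a coloured entry.\<close>

lemma card_Int_lessThan_ge:
  fixes D T :: "nat set"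
  assumes "finite D" "\<And>i i'. i \<in> D \<Longrightarrow> i' < i \<Longrightarrow> i' \<in> D" "T \<subseteq> D" "card T \<le> r"
  shows "card T \<le> card {i \<in> D. i < r}"
proof (cases "\<forall>i\<in>D. i < r")
  case True
  then have "{i \<in> D. i < r} = D" by auto
  then show ?thesis using assms by (simp add: card_mono)
next
  case False
  then obtain d where "d \<in> D" "r \<le> d" by (auto simp: not_less)
  then have "{i \<in> D. i < r} = {..<r}"
    using assms(2)[of d] by (auto dest: less_le_trans)
  then show ?thesis using assms by simp
qed

section \<open>Young diagrams counted by rows and by columns\<close>

definition cells :: "nat list \<Rightarrow> (nat \<times> nat) set" where
  "cells \<mu> = {(i, j). j < nth_default 0 \<mu> i}"

lemma finite_cells [simp]: "finite (cells \<mu>)"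
proof -
  have "cells \<mu> = (SIGMA i:{..<length \<mu>}. {..<\<mu> ! i})"
    by (auto simp: cells_def nth_default_def split: if_splits)
  then show ?thesis by simp
qed

lemma card_cells_rows: "card {(i, j) \<in> cells \<mu>. i < r} = (\<Sum>i<r. nth_default 0 \<mu> i)"
proof -
  have "{(i, j) \<in> cells \<mu>. i < r} = (SIGMA i:{..<r}. {..<nth_default 0 \<mu> i})"
    by (auto simp: cells_def)
  then show ?thesis by simp
qed

lemma card_eq_sum_columns:
  assumes "finite S" "finite J" "snd ` S \<subseteq> J"
  shows "card S = (\<Sum>j\<in>J. card {i. (i, j) \<in> S})"
proof -
  \<comment> \<open>A \<open>SIGMA\<close> set is fibred over its first coordinate, so the relation
    is inverted to be counted by columns.\<close>
  have "S\<inverse> = (SIGMA j:J. {i. (i, j) \<in> S})" using assms(3) by force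
  moreover have "finite {i. (i, j) \<in> S}" for j
    by (rule finite_subset[OF _ finite_imageI[OF assms(1), of fst]]) force
  ultimately show ?thesis
    using card_inverse[of S] assms(2) by simp
qed

text \<open>Columns of a tableau decrease along the reading word, so each meets a colour class at most once.\<close>

lemma card_coloured_tableau_inc:
  assumes "tableau P" "inc_colouring r c (reading_word P)"
  shows "card (coloured r c (reading_word P)) \<le> (\<Sum>i<r. nth_default 0 (tableau_shape P) i)"
proof -
  define C where "C = cells (tableau_shape P)"
  define S where "S = {(i, j) \<in> C. c (P ! i ! j) < r}"
  define C' where "C' = {(i, j) \<in> C. i < r}"
  define J where "J = snd ` C"
  have C: "(i, j) \<in> C \<longleftrightarrow> i < length P \<and> j < length (P ! i)" for i j
    by (auto simp: C_def cells_def tableau_shape_def nth_default_def split: if_splits)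
  have fin: "finite C" "finite S" "finite C'" "finite J"
    by (auto simp: C_def S_def C'_def J_def intro: finite_subset[OF _ finite_cells])
  have fin_col: "finite {i. (i, j) \<in> C}" for j
    by (rule finite_subset[OF _ finite_imageI[OF fin(1), of fst]]) force
  have down: "(i', j) \<in> C" if "(i, j) \<in> C" "i' < i" for i i' j
    using tableau_nth[OF assms(1), of i' i] that by (auto simp: C)
  have "coloured r c (reading_word P) \<subseteq> (\<lambda>(i, j). P ! i ! j) ` S"
  proof
    fix a
    assume "a \<in> coloured r c (reading_word P)"
    then obtain row where "row \<in> set P" "a \<in> set row" "c a < r"
      by (auto simp: coloured_def set_reading_word)
    then obtain i j where "i < length P" "j < length (P ! i)" "a = P ! i ! j" "c a < r"
      by (metis in_set_conv_nth)
    then show "a \<in> (\<lambda>(i, j). P ! i ! j) ` S"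
      by (intro image_eqI[of _ _ "(i, j)"]) (auto simp: S_def C)
  qed
  then have "card (coloured r c (reading_word P)) \<le> card S"
    using surj_card_le[OF fin(2)] by blast
  also have "card S = (\<Sum>j\<in>J. card {i. (i, j) \<in> S})"
    using fin by (intro card_eq_sum_columns) (auto simp: S_def J_def)
  also have "\<dots> \<le> (\<Sum>j\<in>J. card {i. (i, j) \<in> C'})"
  proof (rule sum_mono)
    fix j
    let ?T = "{i. (i, j) \<in> S}"
    have neq: "c (P ! i' ! j) \<noteq> c (P ! i ! j)" if "i \<in> ?T" "i' \<in> ?T" "i < i'" for i i'
    proof
      assume "c (P ! i' ! j) = c (P ! i ! j)"
      moreover have "c (P ! i' ! j) < r \<and> c (P ! i' ! j) = c (P ! i ! j) \<longrightarrow> P ! i' ! j < P ! i ! j"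
        using that assms(2) unfolding inc_colouring_def
        by (intro sorted_wrt_reading_word[where Q = "\<lambda>a b. c a < r \<and> c a = c b \<longrightarrow> a < b" and i = i and i' = i' and P = P])
          (auto simp: S_def C)
      moreover have "P ! i ! j < P ! i' ! j"
        using tableau_nth[OF assms(1), of i i'] that by (auto simp: S_def C)
      ultimately show False using that by (auto simp: S_def)
    qed
    have "inj_on (\<lambda>i. c (P ! i ! j)) ?T"
      by (rule linorder_inj_onI) (use neq in force)+
    then have "card ?T \<le> card {..<r}"
      by (rule card_inj_on_le) (auto simp: S_def)
    \<comment> \<open>A column occupies an initial segment of rows and has at most \<open>r\<close>
      coloured entries, hence no more of them than cells in the first \<open>r\<close> rows.\<close>
    then have "card ?T \<le> card {i \<in> {i. (i, j) \<in> C}. i < r}"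
      using down fin_col by (intro card_Int_lessThan_ge) (auto simp: S_def)
    also have "{i \<in> {i. (i, j) \<in> C}. i < r} = {i. (i, j) \<in> C'}"
      by (auto simp: C'_def)
    finally show "card ?T \<le> card {i. (i, j) \<in> C'}" .
  qed
  also have "\<dots> = card C'"
    using fin by (intro card_eq_sum_columns[symmetric]) (auto simp: C'_def J_def)
  finally show ?thesis by (simp add: C'_def C_def card_cells_rows)
qed

text \<open>Rows increase, so a decreasing class meets each row at most once, and a row of length
  \<open>l\<close> has at most \<open>min l r\<close> coloured letters. The sum on the right counts
  the cells in the first \<open>r\<close> columns.\<close>

lemma card_coloured_tableau_dec:
  assumes "tableau P" "inc_colouring r c (rev (reading_word P))"
  shows "card (coloured r c (reading_word P)) \<le> (\<Sum>l\<leftarrow>tableau_shape P. min l r)"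
  using assms
proof (induction P)
  case Nil
  then show ?case by (simp add: coloured_def reading_word_def)
next
  case (Cons row rs)
  have word: "reading_word (row # rs) = reading_word rs @ row" by (simp add: reading_word_def)
  have col: "inc_colouring r c (rev row)" "inc_colouring r c (rev (reading_word rs))"
    using Cons.prems(2) by (auto simp: word inc_colouring_def sorted_wrt_append)
  have IH: "card (coloured r c (reading_word rs)) \<le> (\<Sum>l\<leftarrow>tableau_shape rs. min l r)"
    using Cons.IH Cons.prems(1) col(2) by simp
  have neq: "c a \<noteq> c b" if ab: "a \<in> coloured r c row" "b \<in> coloured r c row" "a < b" for a b
  proof -
    obtain i j where ij: "i < length row" "a = row ! i" "j < length row" "b = row ! j"
      using ab(1,2) unfolding coloured_def by (metis (no_types, lifting) in_set_conv_nth mem_Collect_eq)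
    have "sorted_wrt (<) row" using Cons.prems(1) by simp
    then have "i < j" using ij ab(3)
      by (metis less_asym linorder_neqE_nat order_less_irrefl sorted_wrt_iff_nth_less)
    then have "c b < r \<and> c b = c a \<longrightarrow> b < a"
      using col(1) ij unfolding inc_colouring_def sorted_wrt_rev
      by (simp add: sorted_wrt_iff_nth_less)
    then show ?thesis using ab by (auto simp: coloured_def)
  qed
  have "inj_on c (coloured r c row)"
    by (rule linorder_inj_onI) (use neq in force)+
  then have "card (coloured r c row) \<le> card {..<r}"
    by (rule card_inj_on_le) (auto simp: coloured_def)
  moreover have "card (coloured r c row) \<le> length row"
    by (rule order_trans[OF card_mono card_length]) (auto simp: coloured_def)
  ultimately have row: "card (coloured r c row) \<le> min (length row) r" by simp
  have "coloured r c (reading_word (row # rs)) = coloured r c (reading_word rs) \<union> coloured r c row"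
    by (auto simp: word coloured_def)
  then have "card (coloured r c (reading_word (row # rs)))
      \<le> card (coloured r c (reading_word rs)) + card (coloured r c row)"
    by (simp add: card_Un_le)
  also have "\<dots> \<le> (\<Sum>l\<leftarrow>tableau_shape rs. min l r) + min (length row) r"
    using IH row by (rule add_mono)
  finally show ?case by (simp add: tableau_shape_def add.commute)
qed

section \<open>Greene's bounds carried from the reading word back to the word\<close>

lemma card_coloured_le_rs_shape_inc:
  assumes "distinct w" "inc_colouring r c w"
  shows "card (coloured r c w) \<le> (\<Sum>i<r. nth_default 0 (rs_shape w) i)"
proof -
  have "tableau (fst (robinson_schensted w))"
    "knuth_step\<^sup>*\<^sup>* w (reading_word (fst (robinson_schensted w)))"
    using robinson_schensted_knuth_steps[OF assms(1)] by auto
  then show ?thesis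
    using inc_colouring_knuth_steps[OF _ assms] card_coloured_tableau_inc
    unfolding rs_shape_def by metis
qed

text \<open>The Knuth steps are reversed so that the increasing colouring of \<open>rev w\<close>
  can be pushed along them; reversal does not affect which letters are coloured.\<close>

lemma card_coloured_le_rs_shape_dec:
  assumes "distinct w" "inc_colouring r c (rev w)"
  shows "card (coloured r c w) \<le> (\<Sum>l\<leftarrow>rs_shape w. min l r)"
proof -
  have T: "tableau (fst (robinson_schensted w))"
    and K: "knuth_step\<^sup>*\<^sup>* w (reading_word (fst (robinson_schensted w)))"
    using robinson_schensted_knuth_steps[OF assms(1)] by auto
  have rev: "coloured r c' (rev v) = coloured r c' v" for c' and v :: "'a list"
    by (simp add: coloured_def)
  show ?thesis
    using inc_colouring_knuth_steps[OF knuth_steps_rev[OF K] _ assms(2)] assms(1)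
      card_coloured_tableau_dec[OF T]
    unfolding rs_shape_def rev by (metis distinct_rev)
qed

lemma sum_list_rs_shape:
  assumes "distinct w"
  shows "sum_list (rs_shape w) = length w"
proof -
  have "mset (reading_word (fst (robinson_schensted w))) = mset w"
    using robinson_schensted_knuth_steps[OF assms] knuth_steps_mset by blast
  then have "length (reading_word (fst (robinson_schensted w))) = length w"
    by (metis size_mset)
  then show ?thesis
    by (simp add: reading_word_def length_concat rs_shape_def tableau_shape_def flip: rev_map)
qed

lemma is_partition_rs_shape:
  assumes "distinct w"
  shows "is_partition (rs_shape w)"
proof -
  have T: "tableau (fst (robinson_schensted w))"
    using robinson_schensted_knuth_steps[OF assms] by simp
  have "[] \<notin> set P" if "tableau P" for P :: "'a list list"
    using that by (induction P) auto
  then show ?thesis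
    using T tableau_nth[OF T] unfolding is_partition_def rs_shape_def tableau_shape_def
    by (auto simp: sorted_wrt_iff_nth_less)
qed

section \<open>Partitions determined by their truncated sums\<close>

text \<open>Pads partitions of different lengths to a common index range; \<open>h 0 = 0\<close>
  makes the padding harmless.\<close>

lemma sum_list_nth_default:
  fixes h :: "nat \<Rightarrow> nat"
  assumes "length \<mu> \<le> L" "h 0 = 0"
  shows "sum_list (map h \<mu>) = (\<Sum>i<L. h (nth_default 0 \<mu> i))"
proof -
  have "sum_list (map h \<mu>) = (\<Sum>i<length \<mu>. h (nth_default 0 \<mu> i))"
    by (simp add: sum_list_sum_nth atLeast0LessThan nth_default_def)
  also have "\<dots> = (\<Sum>i<L. h (nth_default 0 \<mu> i))"
    using assms by (intro sum.mono_neutral_left) (auto simp: nth_default_beyond)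
  finally show ?thesis .
qed

lemma antimono_nth_default: "is_partition \<mu> \<Longrightarrow> i \<le> j \<Longrightarrow> nth_default 0 \<mu> j \<le> nth_default 0 \<mu> i"
  by (cases "i = j") (auto simp: is_partition_def nth_default_def sorted_wrt_iff_nth_less)

lemma nth_default_pos: "is_partition \<mu> \<Longrightarrow> i < length \<mu> \<Longrightarrow> 0 < nth_default 0 \<mu> i"
  by (metis is_partition_def nth_default_nth nth_mem gr0I)

text \<open>Zero padding hides the length, but parts are positive: a longer list has a nonzero part
  where the shorter one is padded.\<close>

lemma partition_eqI:
  assumes "is_partition \<mu>" "is_partition \<nu>" "nth_default 0 \<mu> = nth_default 0 \<nu>"
  shows "\<mu> = \<nu>"
proof (rule nth_equalityI)
  have "length a \<le> length b" if "is_partition a" "nth_default 0 a = nth_default 0 b" for a b :: "nat list"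
    using that nth_default_pos[of a "length b"] by (metis leI less_irrefl nth_default_beyond order_refl)
  then show len: "length \<mu> = length \<nu>" using assms by (metis le_antisym)
  show "\<mu> ! i = \<nu> ! i" if "i < length \<mu>" for i
    using that len assms(3) by (metis nth_default_nth)
qed

text \<open>
  At the first index \<open>p\<close> where the partitions differ, the row sums force \<open>\<mu>\<close> to be smaller, and
  then truncation at the height of its \<open>p\<close>-th part violates the column inequality.
\<close>

lemma partition_eq_if_truncated_sums_le:
  assumes "is_partition \<mu>" "is_partition \<nu>" "sum_list \<mu> = sum_list \<nu>"
    and rows: "\<And>r. (\<Sum>i<r. nth_default 0 \<mu> i) \<le> (\<Sum>i<r. nth_default 0 \<nu> i)"
    and cols: "\<And>c. (\<Sum>l\<leftarrow>\<mu>. min l c) \<le> (\<Sum>l\<leftarrow>\<nu>. min l c)"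
  shows "\<mu> = \<nu>"
proof (rule ccontr)
  define f where "f = nth_default 0 \<mu>"
  define g where "g = nth_default 0 \<nu>"
  define L where "L = max (length \<mu>) (length \<nu>)"
  assume "\<mu> \<noteq> \<nu>"
  then have ex: "\<exists>i. f i \<noteq> g i" using partition_eqI assms(1,2) unfolding f_def g_def by blast
  define p where "p = (LEAST i. f i \<noteq> g i)"
  have p: "f p \<noteq> g p" using ex unfolding p_def by (rule LeastI_ex)
  have below: "f i = g i" if "i < p" for i
    using that not_less_Least unfolding p_def by blast
  have fp: "f p < g p"
  proof -
    have "(\<Sum>i<Suc p. f i) \<le> (\<Sum>i<Suc p. g i)" using rows[of "Suc p"] unfolding f_def g_def .
    moreover have "(\<Sum>i<p. f i) = (\<Sum>i<p. g i)" using below by simp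
    ultimately show ?thesis using p by simp
  qed
  have pL: "p < L" using fp unfolding g_def L_def by (auto simp: nth_default_def split: if_splits)
  have split: "(\<Sum>i<L. h i) = (\<Sum>i<p. h i) + (\<Sum>i\<in>{p..<L}. h i)" for h :: "nat \<Rightarrow> nat"
    using pL by (metis atLeast0LessThan le0 less_imp_le sum.atLeastLessThan_concat)
  have "(\<Sum>i<L. f i) = (\<Sum>i<L. g i)"
    using assms(3) sum_list_nth_default[of \<mu> L "\<lambda>x. x"] sum_list_nth_default[of \<nu> L "\<lambda>x. x"]
    by (simp add: f_def g_def L_def)
  then have tail: "(\<Sum>i\<in>{p..<L}. f i) = (\<Sum>i\<in>{p..<L}. g i)"
    using below by (simp add: split)
  have "(\<Sum>i<L. min (f i) (f p)) \<le> (\<Sum>i<L. min (g i) (f p))"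
    using cols[of "f p"] sum_list_nth_default[of \<mu> L "\<lambda>x. min x (f p)"]
      sum_list_nth_default[of \<nu> L "\<lambda>x. min x (f p)"]
    by (simp add: f_def g_def L_def)
  then have "(\<Sum>i\<in>{p..<L}. min (f i) (f p)) \<le> (\<Sum>i\<in>{p..<L}. min (g i) (f p))"
    using below by (simp add: split)
  \<comment> \<open>From index \<open>p\<close> on, the parts of \<mu> are at most
    \<open>f p\<close>, so truncation leaves them alone, while it strictly cuts part
    \<open>p\<close> of \<nu>.\<close>
  moreover have "(\<Sum>i\<in>{p..<L}. min (f i) (f p)) = (\<Sum>i\<in>{p..<L}. f i)"
    by (intro sum.cong) (auto simp: f_def antimono_nth_default[OF assms(1)] min_absorb1)
  moreover have "(\<Sum>i\<in>{p..<L}. min (g i) (f p)) < (\<Sum>i\<in>{p..<L}. g i)"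
    using pL fp by (intro sum_strict_mono_ex1) (auto intro!: bexI[of _ p])
  ultimately show False using tail by simp
qed

section \<open>Permutations of rectangular shape\<close>

text \<open>The level of \<open>a\<close> is the size of a largest chain strictly below
  \<open>a\<close>. Adding \<open>a\<close> to that chain bounds the level by \<open>m\<close>, and
  by transitivity the longer chain lies below every \<open>b\<close> with
  \<open>R a b\<close>.\<close>

lemma chain_levels:
  assumes "finite X" "transp_on X R" "irreflp_on X R"
    and chains: "\<And>C. C \<subseteq> X \<Longrightarrow> (\<forall>a\<in>C. \<forall>b\<in>C. a \<noteq> b \<longrightarrow> R a b \<or> R b a) \<Longrightarrow> card C \<le> m"
  shows "\<exists>h. (\<forall>a\<in>X. h a < m) \<and> (\<forall>a\<in>X. \<forall>b\<in>X. R a b \<longrightarrow> h a < (h b :: nat))"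
proof -
  define chain where "chain = (\<lambda>C. \<forall>a\<in>C. \<forall>b\<in>C. a \<noteq> b \<longrightarrow> R a b \<or> R b a)"
  define K where "K = (\<lambda>a. {C. C \<subseteq> {b\<in>X. R b a} \<and> chain C})"
  define h where "h = (\<lambda>a. Max (card ` K a))"
  have fin: "finite (K a)" for a
    using assms(1) by (auto simp: K_def intro: finite_subset[of _ "Pow X"])
  \<comment> \<open>The empty chain ensures that \<open>Max\<close> is taken over a nonempty
    set.\<close>
  have ne: "{} \<in> K a" for a by (auto simp: K_def chain_def)
  have extend: "\<exists>C. C \<subseteq> insert a {b\<in>X. R b a} \<and> chain C \<and> card C = Suc (h a)"
    if "a \<in> X" for a
  proof -
    have "Max (card ` K a) \<in> card ` K a"
      using fin ne by (intro Max_in) auto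
    then obtain C where C: "C \<in> K a" "card C = h a" unfolding h_def by force
    then have "finite C" "a \<notin> C"
      using assms(1,3) that by (auto simp: K_def irreflp_on_def intro: finite_subset)
    moreover have "chain (insert a C)" using C(1) by (auto simp: K_def chain_def)
    ultimately show ?thesis using C by (intro exI[of _ "insert a C"]) (auto simp: K_def)
  qed
  have "h a < m" if a: "a \<in> X" for a
  proof -
    obtain C where C: "C \<subseteq> insert a {b\<in>X. R b a}" "chain C" "card C = Suc (h a)"
      using extend[OF a] by blast
    then have "card C \<le> m" using a by (intro chains) (auto simp: chain_def)
    then show ?thesis using C by simp
  qed
  moreover have "h a < h b" if a: "a \<in> X" and b: "b \<in> X" and ab: "R a b" for a b
  proof -
    obtain C where C: "C \<subseteq> insert a {b\<in>X. R b a}" "chain C" "card C = Suc (h a)"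
      using extend[OF a] by blast
    have "C \<in> K b"
      using C a b ab assms(2) unfolding K_def by (auto dest: transp_onD)
    then have "card C \<le> h b" unfolding h_def using fin by (intro Max_ge) auto
    then show ?thesis using C by simp
  qed
  ultimately show ?thesis by blast
qed

lemma sorted_wrt_subseq: "subseq s w \<Longrightarrow> sorted_wrt P w \<Longrightarrow> sorted_wrt P s"
  by (induction rule: list_emb.induct) (auto dest: list_emb_set)

lemma subseq_distinct: "subseq s w \<Longrightarrow> distinct w \<Longrightarrow> distinct s"
  by (induction rule: list_emb.induct) (auto dest: list_emb_set)

lemma subseq_rev: "subseq s w \<Longrightarrow> subseq (rev s) (rev w)"
  by (induction rule: list_emb.induct) (auto intro: list_emb_append_mono)

text \<open>Rewrites order in the word as a relation between letters, so that chains can be plain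
  sets of letters.\<close>

lemma sorted_wrt_position:
  assumes "\<And>i. i < length w \<Longrightarrow> pos (w ! i) = i"
  shows "sorted_wrt P w \<longleftrightarrow> (\<forall>a\<in>set w. \<forall>b\<in>set w. pos a < pos b \<longrightarrow> P a b)"
  by (auto simp: sorted_wrt_iff_nth_less all_set_conv_all_nth assms)

text \<open>
  The level functions of longest decreasing and increasing subsequences map the letters
  injectively, hence bijectively, onto the \<open>k \<times> m\<close> grid.
\<close>

lemma rectangular_grid:
  fixes w :: "'a::linorder list"
  assumes "distinct w" "rs_shape w = replicate k m" "m \<ge> 1" "k \<ge> 1"
  shows "\<exists>f g. bij_betw (\<lambda>a. (f a, g a)) (set w) ({..<k} \<times> {..<m}) \<and>
    (\<forall>r. inc_colouring r f w) \<and> (\<forall>r. inc_colouring r g (rev w))"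
proof -
  define pos where "pos = the_inv_into {..<length w} (nth w)"
  have inj: "inj_on (nth w) {..<length w}" using assms(1) by (simp add: inj_on_nth)
  have pos: "pos (w ! i) = i" if "i < length w" for i
    unfolding pos_def using the_inv_into_f_f[OF inj] that by simp
  have sorted: "sorted_wrt P w \<longleftrightarrow> (\<forall>a\<in>set w. \<forall>b\<in>set w. pos a < pos b \<longrightarrow> P a b)" for P
    by (rule sorted_wrt_position) (rule pos)
  have pos_inj: "a = b" if "a \<in> set w" "b \<in> set w" "pos a = pos b" for a b
    using that pos by (metis in_set_conv_nth)
  have inc_chain: "card C \<le> m"
    if C: "C \<subseteq> set w" "\<forall>a\<in>C. \<forall>b\<in>C. a \<noteq> b \<longrightarrow> (pos a < pos b \<and> a < b) \<or> (pos b < pos a \<and> b < a)" for C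
  proof -
    \<comment> \<open>The chain becomes the single class 0 for \<open>r = 1\<close>; colour 1 means
      uncoloured.\<close>
    define c :: "'a \<Rightarrow> nat" where "c = (\<lambda>a. if a \<in> C then 0 else 1)"
    have "inc_colouring 1 c w"
      unfolding inc_colouring_def sorted
    proof (intro ballI impI)
      fix a b
      assume less: "pos a < pos b" and "c a < 1 \<and> c a = c b"
      then have "a \<in> C" "b \<in> C" by (auto simp: c_def split: if_splits)
      then show "a < b" using C(2)[rule_format, of a b] less by auto
    qed
    from card_coloured_le_rs_shape_inc[OF assms(1) this]
    \<comment> \<open>The first row of the rectangle exists because \<open>k \<ge> 1\<close>, and it
      has length \<open>m\<close>.\<close>
    have "card (coloured 1 c w) \<le> m"
      using assms by (simp add: nth_default_def)
    moreover have "coloured 1 c w = C" using C(1) by (auto simp: coloured_def c_def)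
    ultimately show ?thesis by simp
  qed
  have "\<exists>g. (\<forall>a\<in>set w. g a < m) \<and>
      (\<forall>a\<in>set w. \<forall>b\<in>set w. pos a < pos b \<and> a < b \<longrightarrow> g a < (g b :: nat))"
  proof (rule chain_levels)
    show "transp_on (set w) (\<lambda>a b. pos a < pos b \<and> a < b)"
      by (rule transp_onI) (meson less_trans)
  qed (use inc_chain in \<open>simp_all add: irreflp_on_def\<close>)
  then obtain g where g: "\<forall>a\<in>set w. g a < m"
      "\<forall>a\<in>set w. \<forall>b\<in>set w. pos a < pos b \<and> a < b \<longrightarrow> g a < (g b :: nat)" by blast
  have dec_chain: "card C \<le> k"
    if C: "C \<subseteq> set w" "\<forall>a\<in>C. \<forall>b\<in>C. a \<noteq> b \<longrightarrow> (pos a < pos b \<and> b < a) \<or> (pos b < pos a \<and> a < b)" for C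
  proof -
    define c :: "'a \<Rightarrow> nat" where "c = (\<lambda>a. if a \<in> C then 0 else 1)"
    have "inc_colouring 1 c (rev w)"
      unfolding inc_colouring_def sorted_wrt_rev sorted
    proof (intro ballI impI)
      fix a b
      assume less: "pos a < pos b" and "c b < 1 \<and> c b = c a"
      then have "a \<in> C" "b \<in> C" by (auto simp: c_def split: if_splits)
      then show "b < a" using C(2)[rule_format, of a b] less by auto
    qed
    from card_coloured_le_rs_shape_dec[OF assms(1) this]
    \<comment> \<open>Since \<open>m \<ge> 1\<close>, each of the \<open>k\<close> parts truncated
      at 1 contributes exactly 1.\<close>
    have "card (coloured 1 c w) \<le> k"
      using assms by (simp add: sum_list_replicate)
    moreover have "coloured 1 c w = C" using C(1) by (auto simp: coloured_def c_def)
    ultimately show ?thesis by simp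
  qed
  have "\<exists>f. (\<forall>a\<in>set w. f a < k) \<and>
      (\<forall>a\<in>set w. \<forall>b\<in>set w. pos a < pos b \<and> b < a \<longrightarrow> f a < (f b :: nat))"
  proof (rule chain_levels)
    show "transp_on (set w) (\<lambda>a b. pos a < pos b \<and> b < a)"
      by (rule transp_onI) (meson less_trans)
  qed (use dec_chain in \<open>simp_all add: irreflp_on_def\<close>)
  then obtain f where f: "\<forall>a\<in>set w. f a < k"
      "\<forall>a\<in>set w. \<forall>b\<in>set w. pos a < pos b \<and> b < a \<longrightarrow> f a < (f b :: nat)" by blast
  \<comment> \<open>A descent would raise the level \<open>f\<close>, so letters of equal
    \<open>f\<close> increase along the word and form a row of the grid. Dually, letters of equal
    \<open>g\<close> form a decreasing column.\<close>
  have f_col: "a < b" if "a \<in> set w" "b \<in> set w" "pos a < pos b" "f a = f b" for a b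
    using f(2) that by (metis less_irrefl neqE)
  have g_col: "b < a" if "a \<in> set w" "b \<in> set w" "pos a < pos b" "g b = g a" for a b
    using g(2) that by (metis less_irrefl neqE)
  have "inj_on (\<lambda>a. (f a, g a)) (set w)"
  proof (rule inj_onI)
    fix a b
    assume "a \<in> set w" "b \<in> set w" "(f a, g a) = (f b, g b)"
    then show "a = b"
      using f_col g_col pos_inj by (metis Pair_inject less_asym linorder_neqE_nat)
  qed
  moreover have "(\<lambda>a. (f a, g a)) ` set w \<subseteq> {..<k} \<times> {..<m}" using f(1) g(1) by auto
  \<comment> \<open>The number of letters equals the number of grid positions, so the injection is
    onto.\<close>
  moreover have "card (set w) = k * m"
    using sum_list_rs_shape[OF assms(1)] assms(1,2) by (simp add: distinct_card sum_list_replicate)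
  ultimately have "bij_betw (\<lambda>a. (f a, g a)) (set w) ({..<k} \<times> {..<m})"
    unfolding bij_betw_def by (simp add: card_image card_subset_eq)
  moreover have "inc_colouring r f w" for r
    unfolding inc_colouring_def sorted using f_col by blast
  moreover have "inc_colouring r g (rev w)" for r
    unfolding inc_colouring_def sorted_wrt_rev sorted using g_col by blast
  ultimately show ?thesis by blast
qed

section \<open>Shapes of subsequences and partitions inside the rectangle\<close>

lemma partition_contained_replicateI:
  "length \<mu> \<le> k \<Longrightarrow> \<forall>l\<in>set \<mu>. l \<le> m \<Longrightarrow> partition_contained \<mu> (replicate k m)"
  by (auto simp: partition_contained_def nth_default_def)

text \<open>The grid colours every letter of \<sigma>, by \<open>k\<close> increasing classes
  through \<open>f\<close> and by \<open>m\<close> decreasing classes through \<open>g\<close>.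
  Greene's bounds then leave no cell of its shape outside the first \<open>k\<close> rows or the
  first \<open>m\<close> columns.\<close>

lemma rs_shape_subseq_contained:
  assumes "distinct \<pi>" "subseq \<sigma> \<pi>" "rs_shape \<pi> = replicate k m" "m \<ge> 1" "k \<ge> 1"
  shows "partition_contained (rs_shape \<sigma>) (replicate k m)"
proof -
  define \<nu> where "\<nu> = rs_shape \<sigma>"
  obtain f g where bij: "bij_betw (\<lambda>a. (f a, g a)) (set \<pi>) ({..<k} \<times> {..<m})"
    and col: "inc_colouring k f \<pi>" "inc_colouring m g (rev \<pi>)"
    using rectangular_grid[OF assms(1,3-5)] by blast
  have dist: "distinct \<sigma>" using subseq_distinct assms by blast
  then have part: "is_partition \<nu>" unfolding \<nu>_def by (rule is_partition_rs_shape)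
  have col': "inc_colouring k f \<sigma>" "inc_colouring m g (rev \<sigma>)"
    using col sorted_wrt_subseq subseq_rev assms(2) unfolding inc_colouring_def by blast+
  have "f a < k \<and> g a < m" if "a \<in> set \<sigma>" for a
  proof -
    have "a \<in> set \<pi>" using list_emb_set[OF assms(2) that] by metis
    then show ?thesis using bij_betwE[OF bij] by blast
  qed
  then have "coloured k f \<sigma> = set \<sigma>" "coloured m g \<sigma> = set \<sigma>"
    by (auto simp: coloured_def)
  moreover have "card (set \<sigma>) = sum_list \<nu>"
    using dist by (simp add: \<nu>_def sum_list_rs_shape distinct_card)
  ultimately have rows: "sum_list \<nu> \<le> (\<Sum>i<k. nth_default 0 \<nu> i)"
    and cols: "sum_list \<nu> \<le> (\<Sum>l\<leftarrow>\<nu>. min l m)"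
    using card_coloured_le_rs_shape_inc[OF dist col'(1)]
      card_coloured_le_rs_shape_dec[OF dist col'(2)] by (auto simp: \<nu>_def)
  have "length \<nu> \<le> k"
  proof (rule ccontr)
    assume "\<not> length \<nu> \<le> k"
    \<comment> \<open>The part with 0-based index \<open>k\<close> exists and is positive, so the
      first \<open>k\<close> parts fall short of the whole sum.\<close>
    then have "(\<Sum>i<k. nth_default 0 \<nu> i) < (\<Sum>i<length \<nu>. nth_default 0 \<nu> i)"
      using nth_default_pos[OF part, of k] by (intro sum_strict_mono2[of _ _ k]) auto
    then show False
      using rows sum_list_nth_default[of \<nu> "length \<nu>" "\<lambda>x. x"] by simp
  qed
  \<comment> \<open>Truncation never raises a part, so it can keep the sum only if it cuts
    none.\<close>
  moreover have "\<forall>l\<in>set xs. l \<le> m" if "sum_list xs \<le> (\<Sum>l\<leftarrow>xs. min l m)" for xs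
    using that
  proof (induction xs)
    case (Cons x xs)
    have "(\<Sum>l\<leftarrow>xs. min l m) \<le> sum_list xs"
      using sum_list_mono[of xs "\<lambda>l. min l m" "\<lambda>l. l"] by simp
    then show ?case using Cons by (auto simp: min_def split: if_splits)
  qed simp
  ultimately show ?thesis
    using cols by (simp add: partition_contained_replicateI flip: \<nu>_def)
qed

lemma exists_subseq_of_shape:
  assumes "distinct \<pi>" "rs_shape \<pi> = replicate k m" "m \<ge> 1" "k \<ge> 1"
    and \<mu>: "is_partition \<mu>" "partition_contained \<mu> (replicate k m)"
  shows "\<exists>\<sigma>. subseq \<sigma> \<pi> \<and> rs_shape \<sigma> = \<mu>"
proof -
  obtain f g where bij: "bij_betw (\<lambda>a. (f a, g a)) (set \<pi>) ({..<k} \<times> {..<m})"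
    and col: "\<forall>r. inc_colouring r f \<pi>" "\<forall>r. inc_colouring r g (rev \<pi>)"
    using rectangular_grid[OF assms(1-4)] by (elim exE conjE) (rule that; assumption)
  \<comment> \<open>The letters whose grid position lies in the diagram of \<mu>, in the order of
    \<pi>.\<close>
  define \<sigma> where "\<sigma> = filter (\<lambda>a. (f a, g a) \<in> cells \<mu>) \<pi>"
  have sub: "subseq \<sigma> \<pi>" by (simp add: \<sigma>_def)
  have dist: "distinct \<sigma>" using assms(1) by (simp add: \<sigma>_def)
  have col': "inc_colouring r f \<sigma>" "inc_colouring r g (rev \<sigma>)" for r
    using col sorted_wrt_subseq subseq_rev sub unfolding inc_colouring_def by blast+
  have box: "cells \<mu> \<subseteq> {..<k} \<times> {..<m}"
    using \<mu>(2) unfolding partition_contained_def cells_def nth_default_def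
    by (auto split: if_splits)
  \<comment> \<open>The predicate \<open>Q\<close> allows one count to serve for all cells, for the
    first rows and for the first columns.\<close>
  have grid: "card {a \<in> set \<sigma>. Q (f a) (g a)} = card {(i, j) \<in> cells \<mu>. Q i j}" for Q
  proof (rule bij_betw_same_card[of "\<lambda>a. (f a, g a)"], rule bij_betw_subset[OF bij])
    show "(\<lambda>a. (f a, g a)) ` {a \<in> set \<sigma>. Q (f a) (g a)} = {(i, j) \<in> cells \<mu>. Q i j}"
    proof safe
      fix i j
      assume ij: "(i, j) \<in> cells \<mu>" "Q i j"
      then have "(i, j) \<in> (\<lambda>a. (f a, g a)) ` set \<pi>"
        using bij box unfolding bij_betw_def by blast
      then show "(i, j) \<in> (\<lambda>a. (f a, g a)) ` {a \<in> set \<sigma>. Q (f a) (g a)}"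
        using ij by (auto simp: \<sigma>_def)
    qed (auto simp: \<sigma>_def)
  qed (auto simp: \<sigma>_def)
  have sum: "(\<Sum>i<length \<mu>. nth_default 0 \<mu> i) = sum_list \<mu>"
    using sum_list_nth_default[of \<mu> "length \<mu>" "\<lambda>x. x"] by simp
  have "\<mu> = rs_shape \<sigma>"
  proof (rule partition_eq_if_truncated_sums_le)
    show "is_partition (rs_shape \<sigma>)" using dist by (rule is_partition_rs_shape)
    have "{(i, j) \<in> cells \<mu>. i < length \<mu>} = cells \<mu>"
      by (auto simp: cells_def nth_default_def split: if_splits)
    then have "card (set \<sigma>) = sum_list \<mu>"
      using grid[of "\<lambda>_ _. True"] card_cells_rows[of \<mu> "length \<mu>"] sum by simp
    then show "sum_list \<mu> = sum_list (rs_shape \<sigma>)"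
      using dist by (simp add: sum_list_rs_shape distinct_card)
    show "(\<Sum>i<r. nth_default 0 \<mu> i) \<le> (\<Sum>i<r. nth_default 0 (rs_shape \<sigma>) i)" for r
      using card_coloured_le_rs_shape_inc[OF dist col'(1)[of r]] grid[of "\<lambda>i _. i < r"]
      by (simp add: coloured_def card_cells_rows)
    show "(\<Sum>l\<leftarrow>\<mu>. min l c) \<le> (\<Sum>l\<leftarrow>rs_shape \<sigma>. min l c)" for c
    proof -
      \<comment> \<open>Row \<open>i\<close> of the diagram has \<open>min\<close> of its part and
        \<open>c\<close> cells in the first \<open>c\<close> columns.\<close>
      have "{(i, j) \<in> cells \<mu>. j < c} = (SIGMA i:{..<length \<mu>}. {..<min (nth_default 0 \<mu> i) c})"
        by (auto simp: cells_def nth_default_def split: if_splits)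
      then have "card {(i, j) \<in> cells \<mu>. j < c} = (\<Sum>l\<leftarrow>\<mu>. min l c)"
        using sum_list_nth_default[of \<mu> "length \<mu>" "\<lambda>x. min x c"] by simp
      then show ?thesis
        using card_coloured_le_rs_shape_dec[OF dist col'(2)[of c]] grid[of "\<lambda>_ j. j < c"]
        by (simp add: coloured_def)
    qed
  qed (rule \<mu>)
  then show ?thesis using sub by blast
qed

theorem theorem1:
  fixes m k n :: nat and \<pi> :: "nat list" and \<mu> :: "nat list"
  assumes "m \<ge> 1" and "k \<ge> 1"
    and "\<pi> \<in> permutations_of_set {1..n}"
    and "rs_shape \<pi> = replicate k m"
    and "is_partition \<mu>"
  shows "(\<exists>\<sigma>. subseq \<sigma> \<pi> \<and> rs_shape \<sigma> = \<mu>) \<longleftrightarrow> partition_contained \<mu> (replicate k m)"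
proof -
  have "distinct \<pi>" using assms(3) by (rule permutations_of_setD)
  then show ?thesis
    using rs_shape_subseq_contained exists_subseq_of_shape assms by blast
qed

end
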